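(* Let $A$ be an octonion division algebra with center $F$, let $n\geq 1$, let $f(x)=c_n x^n+\dots+c_1 x+c_0\in A[x]$ with $c_0,\dots,c_n\in A$, and let $\lambda\in A$. Then $f(x)$ decomposes as $f(x)=g(x)(x-\lambda)$ for some $g(x)\in A[x]$ if and only if $\lambda$ is a root of $f(x)$, in which case $$g(x)=d_{n-1}x^{n-1}+\dots+d_1x+d_0,$$ where for each $k\in\{0,\dots,n-1\}$ $$d_k=c_n\lambda^{n-1-k}+c_{n-1}\lambda^{n-2-k}+\dots+c_{k+1}.$$
   Context: An octonion algebra $A$ over a field $F$ (of any characteristic) is a Cayley-Dickson doubling $A=Q\oplus Q\ell$ of a quaternion algebra $Q$ over $F$, with multiplication $(q+r\ell)(s+t\ell)=qs+\gamma_0\overline{t}r+(r\overline{s}+tq)\ell$ for $q,r,s,t\in Q$, where $\gamma_0\in F^\times$ is fixed and $z\mapsto\overline{z}$ is the canonical involution of $Q$. It is nonassociative but alternative (any two elements lie in an associative subalgebra), so powers of an element and inverses of nonzero elements in a division algebra are well defined. It is a division algebra if every nonzero element is invertible. The ring of (central) polynomials is $A[x]=A\otimes_F F[x]$; the indeterminate $x$ commutes and associates with all elements, and every polynomial is written in the standard form $f(x)=c_nx^n+\dots+c_1x+c_0$ with coefficients $c_i\in A$ on the left. For $\lambda\in A$, $f(\lambda)$ denotes $c_n\lambda^n+\dots+c_1\lambda+c_0\in A$, and $\lambda$ is a root of $f(x)$ if $f(\lambda)=0$. *)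

theory Defs
  imports "HOL-Computational_Algebra.Computational_Algebra"
begin

text \<open>
  Multiplication on the carrier type is only the bare operation \<open>*\<close>: associativity is not
  assumed. The class \<open>power\<close> contributes \<open>1\<close>, \<open>*\<close> and \<open>a ^ Suc n = a * a ^ n\<close>; in an
  alternative algebra the bracketing is irrelevant.
\<close>

locale nonassoc_algebra = vector_space scale
  for scale :: "'f::field \<Rightarrow> 'a::{ab_group_add,power} \<Rightarrow> 'a" (infixr "*s" 75) +
  assumes mult_add_left: "((a::'a) + b) * c = a * c + b * c"
    and mult_add_right: "(a::'a) * (b + c) = a * b + a * c"
    and mult_scale_left: "(r *s a) * b = r *s (a * b)"
    and mult_scale_right: "a * (r *s b) = r *s (a * b)"
    and one_mult: "1 * (a::'a) = a"
    and mult_one: "(a::'a) * 1 = a"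
begin

text \<open>
  \<open>Q\<close> is a quaternion algebra over the base field (sharing the unit of the ambient algebra) with
  standard generators \<open>i\<close>, \<open>j\<close>: outside characteristic 2 it is the symbol algebra
  \<open>i\<^sup>2 = \<alpha>\<close>, \<open>j\<^sup>2 = \<beta>\<close>, \<open>j i = - i j\<close> with \<open>\<alpha>, \<beta> \<noteq> 0\<close>; in characteristic 2 it is
  \<open>i\<^sup>2 + i = \<alpha>\<close>, \<open>j\<^sup>2 = \<beta>\<close>, \<open>j i = (i + 1) j\<close> with \<open>\<beta> \<noteq> 0\<close>.
\<close>

definition quaternion_subalgebra :: "'a set \<Rightarrow> 'a \<Rightarrow> 'a \<Rightarrow> bool" where
  "quaternion_subalgebra Q i j \<longleftrightarrow>
     Q = span {1, i, j, i * j} \<and> distinct [1, i, j, i * j] \<and> independent {1, i, j, i * j} \<and>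
     (\<forall>u\<in>Q. \<forall>v\<in>Q. u * v \<in> Q) \<and>
     (\<forall>u\<in>Q. \<forall>v\<in>Q. \<forall>w\<in>Q. (u * v) * w = u * (v * w)) \<and>
     (\<exists>\<alpha> \<beta>. \<beta> \<noteq> 0 \<and> j * j = \<beta> *s 1 \<and>
        (if CHAR('f) = 2
         then i * i + i = \<alpha> *s 1 \<and> j * i = (i + 1) * j
         else \<alpha> \<noteq> 0 \<and> i * i = \<alpha> *s 1 \<and> j * i = - (i * j)))"

text \<open>
  The canonical involution in coordinates. In characteristic 2 the generator \<open>i\<close> has reduced
  trace 1, so its conjugate is \<open>i + 1\<close>. Values of \<open>bar\<close> outside \<open>Q\<close> are unconstrained.
\<close>

definition canonical_involution :: "'a \<Rightarrow> 'a \<Rightarrow> ('a \<Rightarrow> 'a) \<Rightarrow> bool" where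
  "canonical_involution i j bar \<longleftrightarrow>
     (\<forall>t x y z. bar (t *s 1 + x *s i + y *s j + z *s (i * j)) =
        (if CHAR('f) = 2
         then (t + x) *s 1 + x *s i + y *s j + z *s (i * j)
         else t *s 1 - x *s i - y *s j - z *s (i * j)))"

definition cayley_dickson_doubling :: "'a set \<Rightarrow> ('a \<Rightarrow> 'a) \<Rightarrow> 'f \<Rightarrow> 'a \<Rightarrow> bool" where
  "cayley_dickson_doubling Q bar \<gamma> l \<longleftrightarrow>
     (\<forall>a. \<exists>!(q, r). q \<in> Q \<and> r \<in> Q \<and> a = q + r * l) \<and>
     (\<forall>q\<in>Q. \<forall>r\<in>Q. \<forall>s\<in>Q. \<forall>t\<in>Q.
        (q + r * l) * (s + t * l) =
          (q * s + \<gamma> *s (bar t * r)) + (r * bar s + t * q) * l)"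

end

locale octonion_algebra = nonassoc_algebra scale
  for scale :: "'f::field \<Rightarrow> 'a::{ab_group_add,power} \<Rightarrow> 'a" (infixr "*s" 75) +
  assumes octonion: "\<exists>Q i j bar \<gamma> l. quaternion_subalgebra Q i j \<and>
    canonical_involution i j bar \<and> \<gamma> \<noteq> 0 \<and> cayley_dickson_doubling Q bar \<gamma> l"

locale octonion_division_algebra = octonion_algebra scale
  for scale :: "'f::field \<Rightarrow> 'a::{ab_group_add,power} \<Rightarrow> 'a" (infixr "*s" 75) +
  assumes invertible: "(a::'a) \<noteq> 0 \<Longrightarrow> \<exists>b. a * b = 1 \<and> b * a = 1"

definition nonassoc_center :: "'a::{ab_group_add,power} set" where
  "nonassoc_center = {z. \<forall>a b. z * a = a * z \<and> (z * a) * b = z * (a * b) \<and>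
                      (a * z) * b = a * (z * b) \<and> (a * b) * z = a * (b * z)}"

text \<open>
  The type \<open>'a poly\<close> serves as the underlying group of \<open>A[x]\<close>; the library product and
  evaluation on it need a commutative coefficient semiring, hence the following versions, with a
  central indeterminate and with coefficients on the left.
\<close>

definition poly_mult :: "'a::{ab_group_add,power} poly \<Rightarrow> 'a poly \<Rightarrow> 'a poly" (infixl "\<otimes>" 70)
  where "p \<otimes> q =
    (\<Sum>m\<le>degree p. \<Sum>k\<le>degree q. monom (coeff p m * coeff q k) (m + k))"

definition poly_eval :: "'a::{ab_group_add,power} poly \<Rightarrow> 'a \<Rightarrow> 'a" where
  "poly_eval p a = (\<Sum>k\<le>degree p. coeff p k * a ^ k)"

definition is_root :: "'a::{ab_group_add,power} poly \<Rightarrow> 'a \<Rightarrow> bool" where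
  "is_root p a \<longleftrightarrow> poly_eval p a = 0"

end

theory Submission
  imports Defs
begin

text \<open>
  Write \<open>c\<^sub>k\<close> for the coefficients of \<open>f\<close> and \<open>g\<^sub>k\<close> for those of \<open>g\<close>. Comparing coefficients turns
  \<open>f = g (x - \<lambda>)\<close> into \<open>c\<^sub>0 = - g\<^sub>0 \<lambda>\<close> and \<open>g\<^sub>k = c\<^bsub>k+1\<^esub> + g\<^bsub>k+1\<^esub> \<lambda>\<close>. Since \<open>g\<^sub>k\<close> vanishes for large
  \<open>k\<close>, the second family of equations determines \<open>g\<close> from the top down, in any nonassociative
  algebra: this is Horner's scheme, with the products bracketed as \<open>((c\<^sub>n \<lambda>) \<lambda>) \<cdots>\<close>. The only
  question is whether these brackets can be moved onto the powers of \<open>\<lambda>\<close>, that is, whether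
  \<open>(b \<lambda>\<^sup>k) \<lambda> = b \<lambda>\<^bsup>k+1\<^esup>\<close> for all \<open>b\<close>. If so, the solution is \<open>g\<^sub>k = d\<^sub>k\<close>, and as
  \<open>f(\<lambda>) = c\<^sub>0 + d\<^sub>0 \<lambda>\<close>, the remaining equation for \<open>c\<^sub>0\<close> says exactly that \<open>\<lambda>\<close> is a root
  (\<open>eq_mult_linear_factor_iff\<close>).

  The power law holds in octonion algebras (\<open>power_right_assoc\<close>) because \<open>\<lambda>\<close> has a conjugate
  \<open>\<lambda>'\<close> such that \<open>\<lambda> + \<lambda>' = t\<close> is a scalar and \<open>(b \<lambda>) \<lambda>' = n b\<close> for a scalar \<open>n\<close> and all \<open>b\<close>
  (\<open>octonion_conjugate\<close>, a computation in the Cayley-Dickson doubling). Hence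
  \<open>(b \<lambda>) \<lambda> = b (t \<lambda> - n)\<close>; taking \<open>b = 1\<close> gives \<open>\<lambda>\<^sup>2 = t \<lambda> - n\<close>, and so \<open>(b \<lambda>) \<lambda> = b \<lambda>\<^sup>2\<close>. Every power
  of \<open>\<lambda>\<close> is then a linear combination of \<open>\<lambda>\<close> and \<open>1\<close>, so higher powers follow by linearity
  (\<open>quadratic_power_right_assoc\<close>).
\<close>

section \<open>Powers of a quadratic element\<close>

context nonassoc_algebra
begin

lemma mult_zero_left: "0 * (a::'a) = 0"
  using mult_add_left[of 0 0 a] by simp

lemma mult_zero_right: "(a::'a) * 0 = 0"
  using mult_add_right[of a 0 0] by simp

lemma mult_minus_left: "(- a) * b = - ((a::'a) * b)"
  using mult_add_left[of a "- a" b] by (simp add: mult_zero_left eq_neg_iff_add_eq_0 add.commute)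

lemma mult_minus_right: "a * (- b) = - ((a::'a) * b)"
  using mult_add_right[of a b "- b"] by (simp add: mult_zero_right eq_neg_iff_add_eq_0 add.commute)

lemma mult_diff_left: "(a - b) * c = (a::'a) * c - b * c"
  using mult_add_left[of a "- b" c] by (simp add: mult_minus_left)

lemma mult_diff_right: "a * (b - c) = (a::'a) * b - a * c"
  using mult_add_right[of a b "- c"] by (simp add: mult_minus_right)

lemma mult_sum_left: "(\<Sum>i\<in>I. h i) * (b::'a) = (\<Sum>i\<in>I. h i * b)"
  by (induction I rule: infinite_finite_induct) (simp_all add: mult_zero_left mult_add_left)

lemmas bilinear_simps =
  mult_add_left mult_add_right mult_diff_left mult_diff_right mult_minus_left mult_minus_right
  mult_scale_left mult_scale_right one_mult mult_one mult_zero_left mult_zero_right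

text \<open>
  The quadratic equation keeps all powers of \<open>a\<close> in the span of \<open>a\<close> and \<open>1\<close>, and the claim is
  linear in the power: for \<open>a\<close> it is right alternativity, for \<open>1\<close> it is trivial.
\<close>

lemma quadratic_power_right_assoc:
  fixes a :: 'a
  assumes quadratic: "a * a = t *s a - n *s 1"
    and right_alternative: "\<And>b. (b * a) * a = b * (a * a)"
  shows "(b * a ^ k) * a = b * a ^ Suc k"
proof -
  have "\<exists>r s. a ^ k = r *s a + s *s 1"
  proof (induction k)
    case 0
    have "a ^ 0 = 0 *s a + 1 *s 1"
      by (simp add: power.power.power_0)
    then show ?case by blast
  next
    case (Suc k)
    then obtain r s where rs: "a ^ k = r *s a + s *s 1" by blast
    have "a ^ Suc k = r *s (t *s a - n *s 1) + s *s a"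
      by (simp add: power.power.power_Suc rs bilinear_simps quadratic)
    also have "\<dots> = (r * t + s) *s a + (- (r * n)) *s 1"
      by (simp add: algebra_simps)
    finally show ?case by blast
  qed
  then obtain r s where rs: "a ^ k = r *s a + s *s 1" by blast
  show ?thesis
    by (simp add: power.power.power_Suc rs bilinear_simps right_alternative)
qed

section \<open>Conjugation in quaternion and octonion algebras\<close>

text \<open>
  A single presentation covers every characteristic: \<open>\<tau>\<close> is the reduced trace of \<open>i\<close>, namely \<open>1\<close>
  in characteristic 2 and \<open>0\<close> otherwise, and \<open>\<nu>\<close> is its reduced norm, so the conjugate of \<open>i\<close> is
  \<open>\<tau> - i\<close> and \<open>j i = (\<tau> - i) j\<close>. In characteristic 2 the signs are immaterial.
\<close>

lemma quaternion_uniform_presentation: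
  fixes i j :: 'a
  assumes quaternion: "quaternion_subalgebra Q i j"
    and involution: "canonical_involution i j bar"
  obtains \<tau> \<nu> \<beta> where
    "i * i = \<tau> *s i - \<nu> *s 1" "j * j = \<beta> *s 1" "j * i = \<tau> *s j - i * j"
    "\<And>t x y z. bar (t *s 1 + x *s i + y *s j + z *s (i * j)) =
       (t + \<tau> * x) *s 1 - x *s i - y *s j - z *s (i * j)"
proof (cases "CHAR('f) = 2")
  case True
  from quaternion True obtain \<alpha> \<beta> where
    ij: "j * j = \<beta> *s 1" "i * i + i = \<alpha> *s 1" "j * i = (i + 1) * j"
    unfolding quaternion_subalgebra_def by auto
  have two: "(1::'f) + 1 = 0"
    using of_nat_CHAR[where 'a='f] True by simp
  have neg: "- v = v" for v :: 'a
  proof -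
    have "v + v = (1 + 1) *s v" by (simp only: scale_left_distrib scale_one)
    then show ?thesis by (simp only: two scale_zero_left neg_eq_iff_add_eq_0)
  qed
  have plus: "u - v = u + v" for u v :: 'a
    by (metis neg diff_conv_add_uminus)
  show thesis
  proof (rule that[of 1 "- \<alpha>" \<beta>])
    show "i * i = 1 *s i - (- \<alpha>) *s 1"
      using ij(2) by (metis add_diff_cancel plus add.commute scale_one scale_minus_left neg)
    show "j * i = 1 *s j - i * j"
      using ij(3) by (simp add: mult_add_left one_mult plus add.commute)
    show "bar (t *s 1 + x *s i + y *s j + z *s (i * j)) =
        (t + 1 * x) *s 1 - x *s i - y *s j - z *s (i * j)" for t x y z
      using involution True unfolding canonical_involution_def by (simp add: plus)
  qed (fact ij)
next
  case False
  with quaternion obtain \<alpha> \<beta> where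
    ij: "j * j = \<beta> *s 1" "i * i = \<alpha> *s 1" "j * i = - (i * j)"
    unfolding quaternion_subalgebra_def by auto
  show thesis
  proof (rule that[of 0 "- \<alpha>" \<beta>])
    show "bar (t *s 1 + x *s i + y *s j + z *s (i * j)) =
        (t + 0 * x) *s 1 - x *s i - y *s j - z *s (i * j)" for t x y z
      using involution False unfolding canonical_involution_def by simp
  qed (simp_all add: ij)
qed

text \<open>
  Everything reduces to the trace form \<open>bar q = T - q\<close> and the quadratic equation
  \<open>q\<^sup>2 = T q - N\<close>, which is checked on coordinates; it gives
  \<open>q (T - q) = N = (T - q) q\<close>.
\<close>

lemma quaternion_conjugation:
  fixes i j :: 'a
  assumes quaternion: "quaternion_subalgebra Q i j"
    and involution: "canonical_involution i j bar"
    and q: "q \<in> Q"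
  shows "bar q \<in> Q" "bar (bar q) = q" "bar (- q) = - bar q"
    and "\<exists>t. q + bar q = t *s 1" "\<exists>n. q * bar q = n *s 1 \<and> bar q * q = n *s 1"
proof -
  obtain \<tau> \<nu> \<beta> where
    ii: "i * i = \<tau> *s i - \<nu> *s 1" and jj: "j * j = \<beta> *s 1" and ji: "j * i = \<tau> *s j - i * j"
    and bar: "\<And>t x y z. bar (t *s 1 + x *s i + y *s j + z *s (i * j)) =
       (t + \<tau> * x) *s 1 - x *s i - y *s j - z *s (i * j)"
    using quaternion_uniform_presentation[OF quaternion involution] by metis
  have Q: "Q = span {1, i, j, i * j}"
    and assoc: "\<And>u v w. u \<in> Q \<Longrightarrow> v \<in> Q \<Longrightarrow> w \<in> Q \<Longrightarrow> (u * v) * w = u * (v * w)"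
    using quaternion unfolding quaternion_subalgebra_def by auto
  have gens: "1 \<in> Q" "i \<in> Q" "j \<in> Q" "i * j \<in> Q"
    unfolding Q by (simp_all add: span_base)
  from q have "q \<in> span (insert 1 (insert i (insert j (insert (i * j) {}))))"
    unfolding Q by simp
  then obtain t x y z where "q - t *s 1 - x *s i - y *s j - z *s (i * j) = 0"
    unfolding span_breakdown_eq by auto
  then have coords: "q = t *s 1 + x *s i + y *s j + z *s (i * j)"
    by (simp add: algebra_simps)
  have bar_q: "bar q = (t + \<tau> * x) *s 1 + (- x) *s i + (- y) *s j + (- z) *s (i * j)"
    by (simp add: coords bar)
  show "bar q \<in> Q"
    unfolding bar_q using gens unfolding Q by (intro span_add span_scale)
  show "bar (bar q) = q"
    unfolding bar_q bar by (simp add: coords)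
  have "- q = (- t) *s 1 + (- x) *s i + (- y) *s j + (- z) *s (i * j)"
    by (simp add: coords)
  then show "bar (- q) = - bar q"
    by (simp only: bar) (simp add: bar_q algebra_simps)
  define T where "T = t + t + \<tau> * x"
  have T_scale: "T *s v = t *s v + t *s v + (\<tau> * x) *s v" for v
    by (simp only: T_def scale_left_distrib)
  have bar_trace: "bar q = T *s 1 - q"
    unfolding bar_q unfolding coords T_scale by (simp add: algebra_simps)
  then show "\<exists>t. q + bar q = t *s 1"
    by auto
  have iij: "i * (i * j) = \<tau> *s (i * j) - \<nu> *s j"
    by (simp add: assoc[symmetric] gens ii bilinear_simps)
  have iji: "(i * j) * i = \<nu> *s j"
    by (simp add: assoc gens ji iij bilinear_simps)
  have ijj: "(i * j) * j = \<beta> *s i"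
    by (simp add: assoc gens jj bilinear_simps)
  have jij: "j * (i * j) = (\<tau> * \<beta>) *s 1 - \<beta> *s i"
    by (simp add: assoc[symmetric] gens ji jj ijj bilinear_simps)
  have ijij: "(i * j) * (i * j) = (\<beta> * \<nu>) *s 1"
    by (simp add: assoc gens jij ii bilinear_simps algebra_simps)
  \<comment> \<open>the reduced norm form in the coordinates \<open>t, x, y, z\<close>\<close>
  define N where
    "N = t * t + \<tau> * t * x + \<nu> * x * x - \<beta> * y * y - \<beta> * \<nu> * z * z - \<tau> * \<beta> * y * z"
  have "q * q = T *s q - N *s 1"
    unfolding coords T_scale N_def
    by (simp add: bilinear_simps ii jj ji iij iji ijj jij ijij algebra_simps)
  then have "q * bar q = N *s 1" "bar q * q = N *s 1"
    unfolding bar_trace by (simp_all add: bilinear_simps)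
  then show "\<exists>n. q * bar q = n *s 1 \<and> bar q * q = n *s 1"
    by blast
qed

end

context octonion_algebra
begin

text \<open>
  For \<open>a = q + r l\<close> the conjugate is \<open>bar q - r l\<close>. Multiplying \<open>b = u + v l\<close> by \<open>a\<close> and then by
  this conjugate produces in each component two mixed terms that cancel by associativity in \<open>Q\<close>,
  and terms in which \<open>q\<close> meets \<open>bar q\<close>, or \<open>r\<close> meets \<open>bar r\<close>, which leave the scalar
  \<open>N q - \<gamma> N r\<close>.
\<close>

lemma octonion_conjugate:
  fixes a :: 'a
  obtains a' t n where "a + a' = t *s 1" "\<And>b. (b * a) * a' = n *s b"
proof -
  obtain Q i j bar \<gamma> l where
    quaternion: "quaternion_subalgebra Q i j" and involution: "canonical_involution i j bar"
    and doubling: "cayley_dickson_doubling Q bar \<gamma> l"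
    using octonion by blast
  note conjugation = quaternion_conjugation[OF quaternion involution]
  have split: "\<exists>q\<in>Q. \<exists>r\<in>Q. b = q + r * l" for b
    using doubling unfolding cayley_dickson_doubling_def by blast
  have mult: "(q + r * l) * (s + t * l) = (q * s + \<gamma> *s (bar t * r)) + (r * bar s + t * q) * l"
    if "q \<in> Q" "r \<in> Q" "s \<in> Q" "t \<in> Q" for q r s t
    using doubling that unfolding cayley_dickson_doubling_def by blast
  have Q: "Q = span {1, i, j, i * j}"
    and closed: "\<And>u v. u \<in> Q \<Longrightarrow> v \<in> Q \<Longrightarrow> u * v \<in> Q"
    and assoc: "\<And>u v w. u \<in> Q \<Longrightarrow> v \<in> Q \<Longrightarrow> w \<in> Q \<Longrightarrow> (u * v) * w = u * (v * w)"
    using quaternion unfolding quaternion_subalgebra_def by auto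
  have add: "\<And>u v. u \<in> Q \<Longrightarrow> v \<in> Q \<Longrightarrow> u + v \<in> Q"
    and smult: "\<And>c u. u \<in> Q \<Longrightarrow> c *s u \<in> Q"
    and uminus: "\<And>u. u \<in> Q \<Longrightarrow> - u \<in> Q"
    unfolding Q by (simp_all add: span_add span_scale span_neg)
  from split[of a] obtain q r where qr: "q \<in> Q" "r \<in> Q" and a: "a = q + r * l" by blast
  from conjugation(4)[OF qr(1)] obtain t where t: "q + bar q = t *s 1" by blast
  from conjugation(5)[OF qr(1)] obtain n where n: "q * bar q = n *s 1" "bar q * q = n *s 1"
    by blast
  from conjugation(5)[OF qr(2)] obtain m where m: "r * bar r = m *s 1" "bar r * r = m *s 1"
    by blast
  note bar = conjugation(1)[OF qr(1)] conjugation(1)[OF qr(2)]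
    conjugation(2)[OF qr(1)] conjugation(3)[OF qr(2)]
  show thesis
  proof (rule that[of "bar q + (- r) * l" t "n - \<gamma> * m"])
    show "a + (bar q + (- r) * l) = t *s 1"
      using t by (simp add: a mult_minus_left)
    fix b
    from split[of b] obtain u v where uv: "u \<in> Q" "v \<in> Q" and b: "b = u + v * l" by blast
    let ?w = "u * q + \<gamma> *s (bar r * v)" and ?z = "v * bar q + r * u"
    have Q_mem: "?w \<in> Q" "?z \<in> Q"
      using qr uv bar by (auto intro!: add smult closed)
    have "(b * a) * (bar q + (- r) * l) = (?w + ?z * l) * (bar q + (- r) * l)"
      using uv qr by (simp add: a b mult)
    also have "\<dots> = (?w * bar q + \<gamma> *s (bar (- r) * ?z)) + (?z * bar (bar q) + (- r) * ?w) * l"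
      using Q_mem bar qr by (intro mult uminus)
    also have "?w * bar q + \<gamma> *s (bar (- r) * ?z) = (n - \<gamma> * m) *s u"
    proof -
      have "(u * q) * bar q = n *s u" "bar r * (r * u) = m *s u"
        "(bar r * v) * bar q = bar r * (v * bar q)"
        using assoc[of u q "bar q"] assoc[of "bar r" r u] assoc[of "bar r" v "bar q"] qr uv bar
        by (simp_all add: n m bilinear_simps)
      then show ?thesis
        by (simp add: bar bilinear_simps algebra_simps)
    qed
    also have "?z * bar (bar q) + (- r) * ?w = (n - \<gamma> * m) *s v"
    proof -
      have "(v * bar q) * q = n *s v" "r * (bar r * v) = m *s v" "(r * u) * q = r * (u * q)"
        using assoc[of v "bar q" q] assoc[of r "bar r" v] assoc[of r u q] qr uv bar
        by (simp_all add: n m bilinear_simps)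
      then show ?thesis
        by (simp add: bar bilinear_simps algebra_simps)
    qed
    finally show "(b * a) * (bar q + (- r) * l) = (n - \<gamma> * m) *s b"
      by (simp add: b bilinear_simps algebra_simps)
  qed
qed

lemma power_right_assoc: "(b * a ^ k) * a = b * (a::'a) ^ Suc k"
proof -
  obtain a' t n where trace: "a + a' = t *s 1" and norm: "\<And>b. (b * a) * a' = n *s b"
    using octonion_conjugate[of a] by metis
  have a': "a' = t *s 1 - a"
    using trace by (simp add: algebra_simps)
  have twice: "(b * a) * a = t *s (b * a) - n *s b" for b
    using norm[of b] by (simp add: a' bilinear_simps algebra_simps)
  have quadratic: "a * a = t *s a - n *s 1"
    using twice[of 1] by (simp add: one_mult)
  then have "(b * a) * a = b * (a * a)" for b
    by (simp add: twice bilinear_simps)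
  with quadratic show ?thesis
    by (rule quadratic_power_right_assoc)
qed

end

section \<open>Right division by a linear factor\<close>

context nonassoc_algebra
begin

text \<open>
  The convolution formula does not mention degrees, so the factor \<open>x - a\<close> can be treated through
  its coefficients alone.
\<close>

lemma coeff_poly_mult:
  fixes p q :: "'a poly"
  shows "coeff (p \<otimes> q) n = (\<Sum>m\<le>n. coeff p m * coeff q (n - m))"
proof -
  have inner: "(\<Sum>k\<le>degree q. if m + k = n then coeff p m * coeff q k else 0) =
      (if m \<le> n then coeff p m * coeff q (n - m) else 0)" for m
  proof (cases "m \<le> n")
    case True
    then have "m + k = n \<longleftrightarrow> k = n - m" for k by auto
    with True show ?thesis
      by (auto simp: coeff_eq_0 mult_zero_right)
  qed auto
  have "coeff (p \<otimes> q) n =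
      (\<Sum>m\<le>degree p. \<Sum>k\<le>degree q. if m + k = n then coeff p m * coeff q k else 0)"
    by (simp add: poly_mult_def coeff_sum)
  also have "\<dots> = (\<Sum>m\<le>degree p. if m \<le> n then coeff p m * coeff q (n - m) else 0)"
    by (simp only: inner)
  also have "\<dots> = (\<Sum>m\<le>n. coeff p m * coeff q (n - m))"
    by (rule sum.mono_neutral_cong) (auto simp: coeff_eq_0 mult_zero_left)
  finally show ?thesis .
qed

lemma coeff_mult_linear_factor:
  fixes g :: "'a poly"
  shows "coeff (g \<otimes> (monom 1 1 - monom a 0)) 0 = - (coeff g 0 * a)"
    and "coeff (g \<otimes> (monom 1 1 - monom a 0)) (Suc k) = coeff g k - coeff g (Suc k) * a"
proof -
  show "coeff (g \<otimes> (monom 1 1 - monom a 0)) 0 = - (coeff g 0 * a)"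
    by (simp add: coeff_poly_mult mult_minus_right)
  have "coeff (g \<otimes> (monom 1 1 - monom a 0)) (Suc k) =
      (\<Sum>m\<in>{k, Suc k}. coeff g m * coeff (monom 1 1 - monom a 0) (Suc k - m))"
    unfolding coeff_poly_mult
    by (rule sum.mono_neutral_right) (auto simp: mult_zero_right)
  then show "coeff (g \<otimes> (monom 1 1 - monom a 0)) (Suc k) = coeff g k - coeff g (Suc k) * a"
    by (simp add: mult_minus_right mult_one)
qed

definition horner_coeff :: "(nat \<Rightarrow> 'a) \<Rightarrow> nat \<Rightarrow> 'a \<Rightarrow> nat \<Rightarrow> 'a" where
  "horner_coeff c n a k = (\<Sum>i=k+1..n. c i * a ^ (i - 1 - k))"

lemma horner_coeff_mult:
  assumes "\<And>b k. (b * a ^ k) * a = b * a ^ Suc k"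
  shows "horner_coeff c n a k * a = (\<Sum>i=k+1..n. c i * a ^ (i - k))"
  unfolding horner_coeff_def mult_sum_left
proof (rule sum.cong)
  fix i assume "i \<in> {k+1..n}"
  then have "Suc (i - 1 - k) = i - k" by auto
  with assms[of "c i" "i - 1 - k"] show "c i * a ^ (i - 1 - k) * a = c i * a ^ (i - k)"
    by metis
qed simp

lemma horner_coeff_rec:
  assumes "\<And>b k. (b * a ^ k) * a = b * a ^ Suc k" and "k < n"
  shows "horner_coeff c n a k = c (Suc k) + horner_coeff c n a (Suc k) * a"
proof -
  have "{k+1..n} = insert (Suc k) {Suc k + 1..n}"
    using \<open>k < n\<close> by auto
  then have "horner_coeff c n a k = c (Suc k) + (\<Sum>i=Suc k + 1..n. c i * a ^ (i - 1 - k))"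
    by (simp add: horner_coeff_def power.power.power_0 mult_one)
  then show ?thesis
    by (simp add: horner_coeff_mult[OF assms(1)])
qed

lemma horner_coeff_eq_0: "n \<le> k \<Longrightarrow> horner_coeff c n a k = 0"
  by (simp add: horner_coeff_def)

lemma poly_eval_monom_sum:
  fixes c :: "nat \<Rightarrow> 'a"
  shows "poly_eval (\<Sum>i\<le>n. monom (c i) i) a = (\<Sum>i\<le>n. c i * a ^ i)"
proof -
  let ?f = "\<Sum>i\<le>n. monom (c i) i"
  have coeff: "coeff ?f k = (if k \<le> n then c k else 0)" for k
    by (simp add: coeff_sum)
  have "degree ?f \<le> n"
    by (rule degree_le) (simp add: coeff)
  then have "poly_eval ?f a = (\<Sum>k\<le>n. coeff ?f k * a ^ k)"
    unfolding poly_eval_def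
    by (intro sum.mono_neutral_left) (auto simp: coeff_eq_0 mult_zero_left)
  then show ?thesis by (simp add: coeff)
qed

lemma poly_eval_horner:
  assumes "\<And>b k. (b * a ^ k) * a = b * a ^ Suc k"
  shows "poly_eval (\<Sum>i\<le>n. monom (c i) i) a = c 0 + horner_coeff c n a 0 * a"
proof -
  have "{..n} = insert 0 {0 + 1..n}" by auto
  then have "(\<Sum>i\<le>n. c i * a ^ i) = c 0 + (\<Sum>i=0+1..n. c i * a ^ i)"
    by (simp add: power.power.power_0 mult_one)
  then show ?thesis
    by (simp add: poly_eval_monom_sum horner_coeff_mult[OF assms])
qed

text \<open>
  Both \<open>g\<close> and the Horner coefficients satisfy the same downward recursion and vanish beyond
  the larger of \<open>n\<close> and the degree of \<open>g\<close>, so they agree; the constant coefficient is the only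
  equation left over, and by \<open>poly_eval_horner\<close> it is the root condition.
\<close>

lemma eq_mult_linear_factor_iff:
  fixes c :: "nat \<Rightarrow> 'a" and g :: "'a poly"
  assumes power_assoc: "\<And>b k. (b * a ^ k) * a = b * a ^ Suc k"
  shows "(\<Sum>i\<le>n. monom (c i) i) = g \<otimes> (monom 1 1 - monom a 0) \<longleftrightarrow>
    g = (\<Sum>k<n. monom (horner_coeff c n a k) k) \<and> is_root (\<Sum>i\<le>n. monom (c i) i) a"
    (is "?f = _ \<longleftrightarrow> g = ?d \<and> _")
proof -
  have coeff_f: "coeff ?f k = (if k \<le> n then c k else 0)" for k
    by (simp add: coeff_sum)
  have coeff_d: "coeff ?d k = horner_coeff c n a k" for k
    by (cases "k < n") (simp_all add: coeff_sum horner_coeff_eq_0)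
  have root: "is_root ?f a \<longleftrightarrow> c 0 + horner_coeff c n a 0 * a = 0"
    by (simp add: is_root_def poly_eval_horner[OF power_assoc])
  have d_rec: "horner_coeff c n a k = coeff ?f (Suc k) + horner_coeff c n a (Suc k) * a" for k
    using horner_coeff_rec[OF power_assoc, of k n c]
    by (cases "k < n") (simp_all add: coeff_f horner_coeff_eq_0 mult_zero_left)
  have factor: "?f = g \<otimes> (monom 1 1 - monom a 0) \<longleftrightarrow>
      c 0 + coeff g 0 * a = 0 \<and> (\<forall>k. coeff g k = coeff ?f (Suc k) + coeff g (Suc k) * a)"
    (is "_ \<longleftrightarrow> ?zero g \<and> ?rec g")
  proof -
    have "?f = g \<otimes> (monom 1 1 - monom a 0) \<longleftrightarrow>
        coeff ?f 0 = - (coeff g 0 * a) \<and>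
        (\<forall>k. coeff ?f (Suc k) = coeff g k - coeff g (Suc k) * a)"
      unfolding poly_eq_iff coeff_mult_linear_factor[symmetric] by (metis not0_implies_Suc)
    also have "coeff ?f 0 = - (coeff g 0 * a) \<longleftrightarrow> ?zero g"
      by (simp add: coeff_f eq_neg_iff_add_eq_0)
    also have "(\<forall>k. coeff ?f (Suc k) = coeff g k - coeff g (Suc k) * a) \<longleftrightarrow> ?rec g"
      by (simp only: eq_diff_eq) (metis add.commute)
    finally show ?thesis .
  qed
  have unique: "g = ?d" if "?rec g"
  proof (rule poly_eqI)
    fix k
    show "coeff g k = coeff ?d k"
    proof (cases "k \<le> max n (Suc (degree g))")
      case True
      then have "coeff g k = horner_coeff c n a k"
      proof (induction k rule: inc_induct)
        case base
        then show ?case by (simp add: coeff_eq_0 horner_coeff_eq_0)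
      next
        case (step k)
        then show ?case using that d_rec by metis
      qed
      then show ?thesis by (simp only: coeff_d)
    qed (simp only: coeff_d, simp add: coeff_eq_0 horner_coeff_eq_0)
  qed
  show ?thesis
  proof
    assume "?f = g \<otimes> (monom 1 1 - monom a 0)"
    then have "?zero g" "g = ?d" using factor unique by blast+
    then show "g = ?d \<and> is_root ?f a" using coeff_d root by metis
  next
    assume "g = ?d \<and> is_root ?f a"
    then show "?f = g \<otimes> (monom 1 1 - monom a 0)"
      using factor coeff_d root d_rec by metis
  qed
qed

end

theorem proposition2p1:
  fixes scale :: "'f::field \<Rightarrow> 'a::{ab_group_add,power} \<Rightarrow> 'a"
    and n :: nat and c :: "nat \<Rightarrow> 'a" and f :: "'a poly" and lam :: 'a
  assumes "octonion_division_algebra scale"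
    and "nonassoc_center = range (\<lambda>r. scale r (1::'a))"
    and "n \<ge> 1"
    and "f = (\<Sum>i\<le>n. monom (c i) i)"
  shows "((\<exists>g. f = g \<otimes> (monom 1 1 - monom lam 0)) \<longleftrightarrow> is_root f lam) \<and>
    (\<forall>g. f = g \<otimes> (monom 1 1 - monom lam 0) \<longrightarrow>
       g = (\<Sum>k<n. monom (\<Sum>i=k+1..n. c i * lam ^ (i - 1 - k)) k))"
proof -
  interpret octonion_division_algebra scale by fact
  show ?thesis
    using eq_mult_linear_factor_iff[where n = n and c = c and a = lam, OF power_right_assoc]
    unfolding assms(4) horner_coeff_def by blast
qed

end
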